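(* For every integer $r\ge 3$ and every $0<\varepsilon\le 1/(2r)$ there are $c=c(r,\varepsilon)>0$ and $C=C(r,\varepsilon)>0$ such that for any sequence $p=p_n$ of probabilities \[ \lim_{n\to\infty}\mathbb{P}\big(\mathcal{R}^{(r)}(n,p)\text{ is }\varepsilon\text{-Turánnical}\big)=\begin{cases}0,&\text{if } p_n\le c\,n^{2-r}\text{ for all } n\in\mathbb{N},\\ 1,&\text{if } p_n\ge C\,n^{2-r}\text{ for all } n\in\mathbb{N}.\end{cases} \]
   Context: $\mathcal{R}^{(r)}(n,p)$ is the random $r$-uniform hypergraph on vertex set $[n]$ in which each $r$-subset of $[n]$ is a hyperedge independently with probability $p$. $t_r(n)$ denotes the number of edges of the Turán graph $T_r(n)$, the complete balanced $(r-1)$-partite graph on $n$ vertices. An $r$-uniform hypergraph $\mathcal{F}$ on vertex set $V$ detects a graph $G=(V,E)$ if some hyperedge of $\mathcal{F}$ induces a copy of $K_r$ in $G$. $\mathcal{F}$ (on $n$ vertices) is $\varepsilon$-Turánnical if it detects every graph $G$ on $V$ with $e(G)>(1+\varepsilon)t_r(n)$. *)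

theory Defs
  imports "HOL-Probability.Probability" "HOL-Library.Ramsey"
begin

(* A graph on a finite vertex set V is given by its edge set E, with E \<subseteq> [V]\<^bsup>2\<^esup>; an r-uniform hypergraph
   on V is given by its set of hyperedges F, with F \<subseteq> [V]\<^bsup>r\<^esup>. Here [V]\<^bsup>k\<^esup> is the library's nsets V k,
   the set of k-element subsets of V. *)

(* T_r(n) on the vertex set {1..n}: complete multipartite, the r - 1 parts being the residue classes
   modulo r - 1. They are balanced by turan_parts_balanced below (some are empty if n < r - 1).
   Note that T_r(n) is the K_r-free graph, so it has r - 1 and not r parts. *)
definition turan_graph :: "nat \<Rightarrow> nat \<Rightarrow> nat set set" where
  "turan_graph r n =
     {{u, v} | u v. u \<in> {1..n} \<and> v \<in> {1..n} \<and> u mod (r - 1) \<noteq> v mod (r - 1)}"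

definition turan_number :: "nat \<Rightarrow> nat \<Rightarrow> nat" where
  "turan_number r n = card (turan_graph r n)"

lemma turan_part_card:
  fixes i k n :: nat
  assumes "i < k"
  shows "card {v \<in> {1..n}. v mod k = i} = n div k + (if 0 < i \<and> i \<le> n mod k then 1 else 0)"
proof (induction n)
  case 0
  then show ?case by auto
next
  case (Suc n)
  have "{v \<in> {1..Suc n}. v mod k = i} =
      (if Suc n mod k = i then insert (Suc n) {v \<in> {1..n}. v mod k = i}
       else {v \<in> {1..n}. v mod k = i})"
    by (auto simp: le_Suc_eq)
  then have "card {v \<in> {1..Suc n}. v mod k = i} =
      card {v \<in> {1..n}. v mod k = i} + (if Suc n mod k = i then 1 else 0)"
    by simp
  with Suc assms show ?case
    by (auto simp: div_Suc mod_Suc)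
qed

lemma turan_parts_balanced:
  fixes i j k n :: nat
  assumes "i < k" "j < k"
  shows "card {v \<in> {1..n}. v mod k = i} \<le> card {v \<in> {1..n}. v mod k = j} + 1"
  unfolding turan_part_card[OF assms(1)] turan_part_card[OF assms(2)] by auto

definition induced_edges :: "'a set set \<Rightarrow> 'a set \<Rightarrow> 'a set set" where
  "induced_edges E S = {d \<in> E. d \<subseteq> S}"

(* The graph induced by E on e is a copy of K_r iff e has r vertices and all pairs in e are edges. *)
definition detects :: "nat \<Rightarrow> 'a set set \<Rightarrow> 'a set set \<Rightarrow> bool" where
  "detects r F E \<longleftrightarrow> (\<exists>e\<in>F. card e = r \<and> induced_edges E e = [e]\<^bsup>2\<^esup>)"

definition turannical :: "nat \<Rightarrow> real \<Rightarrow> 'a set \<Rightarrow> 'a set set \<Rightarrow> bool" where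
  "turannical r \<epsilon> V F \<longleftrightarrow>
     (\<forall>E. E \<subseteq> [V]\<^bsup>2\<^esup> \<and> real (card E) > (1 + \<epsilon>) * real (turan_number r (card V)) \<longrightarrow> detects r F E)"

(* Independent Bernoulli(p) indicators, one per r-subset of {1..n}; the hypergraph consists of the
   r-subsets whose indicator is True. *)
definition random_hypergraph :: "nat \<Rightarrow> nat \<Rightarrow> real \<Rightarrow> nat set set pmf" where
  "random_hypergraph r n p =
     map_pmf (\<lambda>f. {e \<in> [{1..n}]\<^bsup>r\<^esup>. f e}) (Pi_pmf ([{1..n}]\<^bsup>r\<^esup>) False (\<lambda>_. bernoulli_pmf p))"

end

theory Submission
  imports Defs
begin

text \<open>
  Upper threshold: a graph with more than \<open>(1 + \<epsilon>) t_r(n)\<close> edges contains at least \<open>\<delta> n^r\<close> copies of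
  \<open>K_r\<close>, so the random hypergraph misses all of them with probability at most
  \<open>exp (- p \<delta> n^r) \<le> exp (- C \<delta> n^2)\<close>, which beats a union bound over the fewer than \<open>2^(n^2)\<close> graphs.
  Supersaturation comes from passing to a large induced subgraph of high minimum degree, in which
  cliques can be extended greedily.

  Lower threshold: if there are fewer than \<open>n^2 / (8 r)\<close> hyperedges, deleting from \<open>K_n\<close> one pair inside
  each hyperedge leaves an undetected graph with more than \<open>(1 + \<epsilon>) t_r(n)\<close> edges; this is where
  \<open>\<epsilon> \<le> 1 / (2 r)\<close> enters. Markov's inequality for the number \<open>X\<close> of hyperedges would only give a
  constant bound on the probability, so it is applied to \<open>exp X\<close>.
\<close>

section \<open>Neighbourhoods, cliques and extension of a clique by one vertex\<close>

definition neighbours :: "'a set set \<Rightarrow> 'a set \<Rightarrow> 'a \<Rightarrow> 'a set" where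
  "neighbours E W v = {u \<in> W. {u, v} \<in> E}"

text \<open>A clique is encoded by its vertex set, so that cliques of size \<open>r\<close> and
  hyperedges are objects of the same kind and can be intersected.\<close>

definition cliques :: "'a set set \<Rightarrow> 'a set \<Rightarrow> nat \<Rightarrow> 'a set set" where
  "cliques E W s = {Q \<in> [W]\<^bsup>s\<^esup>. [Q]\<^bsup>2\<^esup> \<subseteq> E}"

lemma finite_cliques: "finite W \<Longrightarrow> finite (cliques E W s)"
  by (simp add: cliques_def finite_imp_finite_nsets)

lemma cliques_mono: "W \<subseteq> V \<Longrightarrow> cliques E W s \<subseteq> cliques E V s"
  unfolding cliques_def using nsets_mono by blast

lemma cliques_0: "cliques E W 0 = {{}}"
  by (auto simp: cliques_def nsets_def)

text \<open>Since \<open>E\<close> contains only 2-subsets, one inclusion is automatic. This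
  translates the equation in \<open>detects\<close> into membership in
  \<open>cliques\<close>.\<close>

lemma clique_iff_induced_edges:
  assumes "E \<subseteq> [V]\<^bsup>2\<^esup>"
  shows "induced_edges E Q = [Q]\<^bsup>2\<^esup> \<longleftrightarrow> [Q]\<^bsup>2\<^esup> \<subseteq> E"
  using assms unfolding induced_edges_def nsets_def by auto

lemma insert_clique:
  assumes "Q \<in> cliques E W s" "u \<in> W" "u \<notin> Q" "\<forall>v\<in>Q. {u, v} \<in> E"
  shows "insert u Q \<in> cliques E W (Suc s)"
proof -
  have "[insert u Q]\<^bsup>2\<^esup> \<subseteq> E"
  proof
    fix d assume "d \<in> [insert u Q]\<^bsup>2\<^esup>"
    then obtain x y where d: "d = {x, y}" "x \<in> insert u Q" "y \<in> insert u Q" "x \<noteq> y"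
      by (auto elim!: nsets2_E)
    show "d \<in> E"
    proof (cases "x \<in> Q \<and> y \<in> Q")
      case True
      with d have "d \<in> [Q]\<^bsup>2\<^esup>" by simp
      with assms(1) show ?thesis by (auto simp: cliques_def)
    next
      case False
      with d assms(4) show ?thesis by (auto simp: insert_commute)
    qed
  qed
  with assms show ?thesis
    by (auto simp: cliques_def nsets_def)
qed

section \<open>Supersaturation from minimum degree\<close>

lemma card_induced_edges_remove:
  assumes "finite W" "v \<in> W" "E \<subseteq> [V]\<^bsup>2\<^esup>"
  shows "card (induced_edges E W) = card (induced_edges E (W - {v})) + card (neighbours E W v)"
proof -
  have eq: "induced_edges E W = induced_edges E (W - {v}) \<union> (\<lambda>u. {u, v}) ` neighbours E W v"
  proof
    show "induced_edges E W \<subseteq> induced_edges E (W - {v}) \<union> (\<lambda>u. {u, v}) ` neighbours E W v"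
    proof
      fix d assume d: "d \<in> induced_edges E W"
      then obtain x y where "d = {x, y}" "x \<noteq> y"
        using assms(3) unfolding induced_edges_def by (auto elim!: nsets2_E)
      with d show "d \<in> induced_edges E (W - {v}) \<union> (\<lambda>u. {u, v}) ` neighbours E W v"
        unfolding induced_edges_def neighbours_def by (auto simp: insert_commute)
    qed
    show "induced_edges E (W - {v}) \<union> (\<lambda>u. {u, v}) ` neighbours E W v \<subseteq> induced_edges E W"
      using assms(2) unfolding induced_edges_def neighbours_def by auto
  qed
  have fin: "finite (induced_edges E (W - {v}))"
    by (rule finite_subset[of _ "Pow W"]) (use assms(1) in \<open>auto simp: induced_edges_def\<close>)
  have inj: "inj_on (\<lambda>u. {u, v}) (neighbours E W v)"
    by (auto simp: inj_on_def doubleton_eq_iff)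
  have "card (induced_edges E W) =
      card (induced_edges E (W - {v})) + card ((\<lambda>u. {u, v}) ` neighbours E W v)"
    unfolding eq using assms(1) fin
    by (intro card_Un_disjoint) (auto simp: induced_edges_def neighbours_def)
  with inj show ?thesis by (simp add: card_image)
qed

text \<open>
  The set \<open>W\<close> maximises \<open>e(W) - a |W| (|W| + 1) / 2\<close>; removing a vertex \<open>v\<close> changes this by
  \<open>a |W| - deg v\<close>, which bounds the degrees from below.
\<close>

lemma dense_graph_min_degree_subgraph:
  fixes a :: real
  assumes "finite V" "E \<subseteq> [V]\<^bsup>2\<^esup>"
  obtains W where "W \<subseteq> V" "\<And>v. v \<in> W \<Longrightarrow> a * card W \<le> card (neighbours E W v)"
    "card (induced_edges E W) - a * card W * (card W + 1) / 2
       \<ge> card E - a * card V * (card V + 1) / 2"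
proof -
  define g where "g = (\<lambda>W. card (induced_edges E W) - a * card W * (card W + 1) / 2)"
  have fin: "finite (g ` Pow V)" "g ` Pow V \<noteq> {}" using assms(1) by auto
  obtain W where W: "W \<subseteq> V" "g W = Max (g ` Pow V)"
    using Max_in[OF fin] by auto
  have max: "g U \<le> g W" if "U \<subseteq> V" for U
    using that fin(1) W(2) by simp
  have "induced_edges E V = E"
    using assms(2) by (auto simp: induced_edges_def nsets_def)
  then have "g V = card E - a * card V * (card V + 1) / 2"
    by (simp add: g_def)
  moreover have "a * card W \<le> card (neighbours E W v)" if v: "v \<in> W" for v
  proof -
    have fW: "finite W" using W(1) assms(1) by (rule finite_subset)
    have "g (W - {v}) \<le> g W" using W(1) by (intro max) auto
    moreover have "card W = Suc (card (W - {v}))"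
      using v fW by (metis card.remove)
    ultimately show ?thesis
      using card_induced_edges_remove[OF fW v assms(2)]
      by (simp add: g_def field_simps)
  qed
  ultimately show ?thesis
    using W(1) max[of V] that unfolding g_def by auto
qed

text \<open>Every vertex of \<open>W\<close> has at most \<open>D\<close> non-neighbours in
  \<open>W\<close>, itself included. Hence a clique of size \<open>s\<close> has at least
  \<open>card W - s * D\<close> common neighbours, while a clique of size \<open>s + 1\<close>
  arises from at most \<open>s + 1\<close> such extensions.\<close>

lemma card_cliques_Suc:
  fixes D :: real
  assumes "finite W" "E \<subseteq> [V]\<^bsup>2\<^esup>"
    and deg: "\<And>v. v \<in> W \<Longrightarrow> card W - D \<le> card (neighbours E W v)"
  shows "(card W - s * D) * card (cliques E W s) \<le> Suc s * card (cliques E W (Suc s))"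
proof -
  define N where "N = (\<lambda>Q. {u \<in> W. \<forall>v\<in>Q. {u, v} \<in> E})"
  have finN: "finite (N Q)" for Q using assms(1) by (simp add: N_def)
  \<comment> \<open>Without loops a common neighbour of \<open>Q\<close> lies outside
    \<open>Q\<close>, so adding it really enlarges the clique.\<close>
  have loop: "{u, u} \<notin> E" for u using assms(2) doubleton_in_nsets_2[of u u V] by blast
  have N: "card W - s * D \<le> card (N Q)" if Q: "Q \<in> cliques E W s" for Q
  proof -
    have Q': "finite Q" "card Q = s" "Q \<subseteq> W" using Q by (auto simp: cliques_def nsets_def)
    have "card (W - N Q) \<le> card (\<Union>v\<in>Q. W - neighbours E W v)"
      using assms(1) Q'(1) by (intro card_mono) (auto simp: N_def neighbours_def)
    also have "\<dots> \<le> (\<Sum>v\<in>Q. card (W - neighbours E W v))"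
      by (rule card_UN_le[OF Q'(1)])
    finally have "real (card (W - N Q)) \<le> (\<Sum>v\<in>Q. real (card (W - neighbours E W v)))"
      by (metis of_nat_le_iff of_nat_sum)
    also have "\<dots> \<le> (\<Sum>v\<in>Q. D)"
    proof (rule sum_mono)
      fix v assume "v \<in> Q"
      then have "v \<in> W" using Q'(3) by auto
      have "neighbours E W v \<subseteq> W" by (auto simp: neighbours_def)
      then have "real (card (W - neighbours E W v)) = real (card W) - card (neighbours E W v)"
        using assms(1) by (metis card_Diff_subset card_mono finite_subset of_nat_diff)
      with deg[OF \<open>v \<in> W\<close>] show "real (card (W - neighbours E W v)) \<le> D" by simp
    qed
    finally have "real (card (W - N Q)) \<le> s * D" using Q'(2) by simp
    moreover have "real (card (W - N Q)) = real (card W) - card (N Q)"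
      using finN assms(1) by (subst card_Diff_subset) (auto simp: N_def intro!: of_nat_diff card_mono)
    ultimately show ?thesis by linarith
  qed
  txt \<open>Double counting of the pairs \<open>(P, u)\<close> with \<open>P\<close> a clique of size \<open>s + 1\<close> and \<open>u \<in> P\<close>.\<close>
  let ?A = "SIGMA Q:cliques E W s. N Q" and ?B = "SIGMA P:cliques E W (Suc s). P"
  have notin: "u \<notin> Q" if "u \<in> N Q" for u Q
    using that loop[of u] by (auto simp: N_def)
  have inj: "inj_on (\<lambda>(Q, u). (insert u Q, u)) ?A"
    by (rule inj_on_inverseI[of _ "\<lambda>(P, u). (P - {u}, u)"])
      (auto dest: notin)
  have img: "(\<lambda>(Q, u). (insert u Q, u)) ` ?A \<subseteq> ?B"
  proof -
    have "insert u Q \<in> cliques E W (Suc s)" if "Q \<in> cliques E W s" "u \<in> N Q" for Q u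
      using that notin[of u Q] by (intro insert_clique) (auto simp: N_def)
    then show ?thesis by auto
  qed
  have finP: "finite P" if "P \<in> cliques E W t" for P t using that by (auto simp: cliques_def nsets_def)
  have "(card W - s * D) * card (cliques E W s) = (\<Sum>Q\<in>cliques E W s. card W - s * D)"
    by simp
  also have "\<dots> \<le> (\<Sum>Q\<in>cliques E W s. real (card (N Q)))"
    by (intro sum_mono N)
  also have "\<dots> = card ?A"
    using finite_cliques[OF assms(1)] finN by (subst card_SigmaI) auto
  also have "card ?A \<le> card ?B"
    using finite_cliques[OF assms(1)] finP
    by (intro card_inj_on_le[OF inj img] finite_SigmaI) auto
  also have "card ?B = (\<Sum>P\<in>cliques E W (Suc s). card P)"
    using finite_cliques[OF assms(1)] finP by (subst card_SigmaI) auto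
  also have "\<dots> = (\<Sum>P\<in>cliques E W (Suc s). Suc s)"
    by (intro sum.cong) (auto simp: cliques_def nsets_def)
  finally show ?thesis by (simp add: mult.commute)
qed

text \<open>Iterates the extension step. All factors \<open>card W - s * D\<close> with
  \<open>s < r\<close> are bounded below by the one at \<open>s = r - 1\<close>, which turns their
  product into a power; the divisors \<open>Suc s\<close> accumulate to the factorial.\<close>

lemma card_cliques_ge:
  fixes D :: real
  assumes "finite W" "E \<subseteq> [V]\<^bsup>2\<^esup>" "D \<ge> 0"
    and deg: "\<And>v. v \<in> W \<Longrightarrow> card W - D \<le> card (neighbours E W v)"
    and pos: "card W - (real r - 1) * D \<ge> 0"
    and "s \<le> r"
  shows "(card W - (real r - 1) * D) ^ s \<le> fact s * card (cliques E W s)"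
  using \<open>s \<le> r\<close>
proof (induction s)
  case 0
  then show ?case by (simp add: cliques_0)
next
  case (Suc s)
  let ?x = "card W - (real r - 1) * D"
  have "real s * D \<le> (real r - 1) * D"
    using Suc.prems assms(3) by (intro mult_right_mono) auto
  then have x: "?x \<le> card W - s * D" by simp
  have "?x ^ Suc s \<le> ?x * (fact s * card (cliques E W s))"
    using Suc pos by (auto intro!: mult_left_mono)
  also have "\<dots> \<le> (card W - s * D) * (fact s * card (cliques E W s))"
    using x by (intro mult_right_mono) auto
  also have "\<dots> = fact s * ((card W - s * D) * card (cliques E W s))" by simp
  also have "\<dots> \<le> fact s * (Suc s * card (cliques E W (Suc s)))"
    using card_cliques_Suc[OF assms(1,2) deg, of s]
    by (metis fact_ge_zero mult_left_mono of_nat_fact of_nat_mult)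
  also have "\<dots> = fact (Suc s) * card (cliques E W (Suc s))" by (simp add: field_simps)
  finally show ?case .
qed

text \<open>In the subgraph of high minimum degree, \<open>D = (1 - a) * card W\<close> makes the
  growth factor proportional to \<open>card W\<close>. For \<open>r \<ge> 2\<close> the coefficient
  is positive exactly when \<open>a\<close> exceeds the Turan density
  \<open>1 - 1 / (r - 1)\<close>.\<close>

lemma clique_supersaturation:
  fixes a \<gamma> :: real
  assumes "finite V" "E \<subseteq> [V]\<^bsup>2\<^esup>" "0 \<le> a" "a \<le> 1" "0 \<le> \<gamma>"
    and b: "(real r - 1) * (1 - a) \<le> 1"
    and dense: "card E \<ge> a * card V * (card V + 1) / 2 + \<gamma> * (card V)\<^sup>2"
  shows "((1 - (real r - 1) * (1 - a)) * sqrt \<gamma> * card V) ^ r \<le> fact r * card (cliques E V r)"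
proof -
  obtain W where W: "W \<subseteq> V" "\<And>v. v \<in> W \<Longrightarrow> a * card W \<le> card (neighbours E W v)"
    "card (induced_edges E W) - a * card W * (card W + 1) / 2
       \<ge> card E - a * card V * (card V + 1) / 2"
    using dense_graph_min_degree_subgraph[OF assms(1,2)] by blast
  have fW: "finite W" using W(1) assms(1) by (rule finite_subset)
  \<comment> \<open>The crude bound \<open>(card W)^2\<close> on the edges inside \<open>W\<close>
    turns the surplus \<open>\<gamma> * (card V)^2\<close> into a linear lower bound on
    \<open>card W\<close>.\<close>
  have "induced_edges E W \<subseteq> (\<lambda>(u, v). {u, v}) ` (W \<times> W)"
  proof (intro subsetI)
    fix d assume d: "d \<in> induced_edges E W"
    then obtain x y where "d = {x, y}"
      using assms(2) unfolding induced_edges_def by (auto elim!: nsets2_E)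
    with d show "d \<in> (\<lambda>(u, v). {u, v}) ` (W \<times> W)"
      by (auto simp: induced_edges_def intro!: image_eqI[of _ _ "(x, y)"])
  qed
  then have "card (induced_edges E W) \<le> card (W \<times> W)"
    using fW by (intro surj_card_le) auto
  then have "real (card (induced_edges E W)) \<le> (real (card W))\<^sup>2"
    by (simp add: card_cartesian_product power2_eq_square flip: of_nat_mult)
  moreover have "0 \<le> a * card W * (card W + 1) / 2" using assms(3) by simp
  ultimately have "\<gamma> * (card V)\<^sup>2 \<le> (real (card W))\<^sup>2"
    using W(3) dense unfolding of_nat_power by linarith
  then have "sqrt (\<gamma> * (card V)\<^sup>2) \<le> sqrt ((real (card W))\<^sup>2)"
    by (rule real_sqrt_le_mono)
  then have w: "sqrt \<gamma> * card V \<le> card W"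
    by (simp add: real_sqrt_mult)
  let ?b = "1 - (real r - 1) * (1 - a)"
  have "(?b * sqrt \<gamma> * card V) ^ r \<le> (?b * card W) ^ r"
    using w b assms(5) by (intro power_mono) (auto simp: mult.assoc intro!: mult_left_mono)
  also have "\<dots> = (card W - (real r - 1) * ((1 - a) * card W)) ^ r"
    by (simp add: algebra_simps)
  also have "\<dots> \<le> fact r * card (cliques E W r)"
  proof (rule card_cliques_ge[OF fW assms(2)])
    have "0 \<le> ?b * card W" using b by simp
    then show "0 \<le> card W - (real r - 1) * ((1 - a) * card W)" by (simp add: algebra_simps)
    show "0 \<le> (1 - a) * card W" using assms(4) by simp
  qed (use W(2) in \<open>auto simp: algebra_simps\<close>)
  also have "\<dots> \<le> fact r * card (cliques E V r)"
    using cliques_mono[OF W(1)] finite_cliques[OF assms(1)] by (auto intro!: card_mono)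
  finally show ?thesis .
qed

section \<open>Edge count of the Turan graph\<close>

lemma card_ordered_edges:
  assumes "finite V" "E \<subseteq> [V]\<^bsup>2\<^esup>"
  shows "card {(u, v) \<in> V \<times> V. {u, v} \<in> E} = 2 * card E"
proof -
  have fE: "finite E" using assms finite_imp_finite_nsets finite_subset by metis
  let ?P = "\<lambda>d. {(u, v). {u, v} = d}"
  have P: "card (?P d) = 2 \<and> finite (?P d)" if "d \<in> E" for d
  proof -
    obtain x y where d: "d = {x, y}" "x \<noteq> y" using \<open>d \<in> E\<close> assms(2) by (auto elim!: nsets2_E)
    then have "?P d = {(x, y), (y, x)}" by (auto simp: doubleton_eq_iff)
    with d(2) show ?thesis by simp
  qed
  have "{(u, v) \<in> V \<times> V. {u, v} \<in> E} = (\<Union>d\<in>E. ?P d)"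
    using assms(2) by auto
  also have "card \<dots> = (\<Sum>d\<in>E. card (?P d))"
    using fE P by (intro card_UN_disjoint) auto
  also have "\<dots> = 2 * card E" using P by simp
  finally show ?thesis .
qed

text \<open>Each of the \<open>r - 1\<close> parts differs from \<open>n / (r - 1)\<close> by at
  most 1, so each degree differs from \<open>q * n\<close> by at most 1. Summing over the
  \<open>n\<close> vertices gives the error \<open>n\<close>.\<close>

lemma turan_number_bounds:
  assumes "r \<ge> 2"
  defines "q \<equiv> 1 - 1 / (real r - 1)"
  shows "q * (real n)\<^sup>2 - n \<le> 2 * turan_number r n"
    and "2 * turan_number r n \<le> q * (real n)\<^sup>2 + n"
proof -
  define k where "k = r - 1"
  have k: "k > 0" "real k = real r - 1" using assms(1) by (auto simp: k_def)
  define P where "P = (\<lambda>u. {v \<in> {1..n}. v mod k = u mod k})"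
  have P: "real n / k - 1 \<le> card (P u) \<and> card (P u) \<le> real n / k + 1" for u
  proof -
    have "u mod k < k" using k by simp
    from turan_part_card[OF this, of n]
    have "n div k \<le> card (P u)" "card (P u) \<le> n div k + 1" by (auto simp: P_def)
    moreover have "real n / k - 1 \<le> n div k" "n div k \<le> real n / k"
    proof -
      have n: "real n = real k * real (n div k) + real (n mod k)"
        by (metis mult_div_mod_eq of_nat_add of_nat_mult)
      have "real (n mod k) \<le> k" using k(1) by (simp add: less_imp_le)
      then show "real n / k - 1 \<le> n div k" "n div k \<le> real n / k"
        using k(1) by (simp_all add: n field_simps del: of_nat_mult of_nat_add)
    qed
    ultimately show ?thesis by linarith
  qed
  have sub: "turan_graph r n \<subseteq> [{1..n}]\<^bsup>2\<^esup>"
    by (auto simp: turan_graph_def)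
  have edge: "{u, v} \<in> turan_graph r n \<longleftrightarrow> u mod k \<noteq> v mod k" if "u \<in> {1..n}" "v \<in> {1..n}" for u v
    using that by (auto simp: turan_graph_def k_def doubleton_eq_iff)
  have "2 * turan_number r n = card {(u, v) \<in> {1..n} \<times> {1..n}. {u, v} \<in> turan_graph r n}"
    using card_ordered_edges[OF _ sub] by (simp add: turan_number_def)
  \<comment> \<open>Ordered edges are grouped by their first vertex \<open>u\<close>, which is
    joined to everything outside its own part \<open>P u\<close>.\<close>
  also have "{(u, v) \<in> {1..n} \<times> {1..n}. {u, v} \<in> turan_graph r n} = (SIGMA u:{1..n}. {1..n} - P u)"
    using edge by (auto simp: P_def)
  also have "card \<dots> = (\<Sum>u\<in>{1..n}. card ({1..n} - P u))"
    by (subst card_SigmaI) auto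
  finally have "real (2 * turan_number r n) = (\<Sum>u\<in>{1..n}. real (card ({1..n} - P u)))"
    by simp
  also have "\<dots> = (\<Sum>u\<in>{1..n}. real n - card (P u))"
  proof (rule sum.cong)
    fix u
    have "P u \<subseteq> {1..n}" by (auto simp: P_def)
    then show "real (card ({1..n} - P u)) = real n - card (P u)"
      using card_mono[of "{1..n}" "P u"] by (subst card_Diff_subset) (auto intro: finite_subset simp: of_nat_diff)
  qed simp
  finally have eq: "2 * turan_number r n = (\<Sum>u\<in>{1..n}. real n - card (P u))" by simp
  have "(\<Sum>u\<in>{1..n}. real n - (real n / k + 1)) \<le> 2 * turan_number r n"
    unfolding eq using P by (intro sum_mono) (simp add: algebra_simps)
  then show "q * (real n)\<^sup>2 - n \<le> 2 * turan_number r n"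
    using k by (simp add: q_def algebra_simps power2_eq_square)
  have "2 * turan_number r n \<le> (\<Sum>u\<in>{1..n}. real n - (real n / k - 1))"
    unfolding eq using P by (intro sum_mono) (simp add: algebra_simps)
  then show "2 * turan_number r n \<le> q * (real n)\<^sup>2 + n"
    using k by (simp add: q_def algebra_simps power2_eq_square)
qed

section \<open>Lower threshold: a deterministic bound on the number of hyperedges\<close>

lemma turannical_imp_many_hyperedges:
  assumes "finite F" "\<And>e. e \<in> F \<Longrightarrow> card e = r" "r \<ge> 2" "finite V"
    and "turannical r \<epsilon> V F"
  shows "real (card V choose 2) - card F \<le> (1 + \<epsilon>) * turan_number r (card V)"
proof (rule ccontr)
  assume contr: "\<not> ?thesis"
  have "\<exists>d. d \<in> [e]\<^bsup>2\<^esup>" if "e \<in> F" for e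
  proof -
    have "card e = r" using that assms(2) by auto
    with assms(3) have "finite e" "2 \<le> card e" by (auto intro: card_ge_0_finite)
    then have "[e]\<^bsup>2\<^esup> \<noteq> {}" by (simp add: nsets_eq_empty_iff)
    then show ?thesis by blast
  qed
  then obtain d where d: "\<And>e. e \<in> F \<Longrightarrow> d e \<in> [e]\<^bsup>2\<^esup>" by metis
  define E where "E = [V]\<^bsup>2\<^esup> - d ` F"
  \<comment> \<open>Hyperedges may share a chosen pair, so at most \<open>card F\<close> pairs are
    deleted.\<close>
  have "card ([V]\<^bsup>2\<^esup>) - card (d ` F) \<le> card E"
    unfolding E_def by (rule diff_card_le_card_Diff) (use assms(1) in auto)
  moreover have "card (d ` F) \<le> card F" using assms(1) by (rule card_image_le)
  ultimately have "real (card V choose 2) - card F \<le> card E" by simp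
  with contr have "real (card E) > (1 + \<epsilon>) * turan_number r (card V)" by linarith
  moreover have "E \<subseteq> [V]\<^bsup>2\<^esup>" by (auto simp: E_def)
  ultimately have "detects r F E" using assms(5) by (auto simp: turannical_def)
  then obtain e where "e \<in> F" "induced_edges E e = [e]\<^bsup>2\<^esup>" by (auto simp: detects_def)
  with d[of e] show False by (auto simp: E_def induced_edges_def)
qed

text \<open>Twice the edge count of the complete graph exceeds twice the allowed number by about
  \<open>n^2 / (2 * r)\<close>, and the deleted pairs must make up for this.\<close>

lemma turannical_card_hyperedges_ge:
  assumes "r \<ge> 3" "0 < \<epsilon>" "\<epsilon> \<le> 1 / (2 * real r)" "n \<ge> 16 * r"
    and "F \<subseteq> [{1..n}]\<^bsup>r\<^esup>" "turannical r \<epsilon> {1..n} F"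
  shows "(real n)\<^sup>2 / (8 * r) \<le> card F"
proof -
  define q where "q = 1 - 1 / (real r - 1)"
  have q: "0 \<le> q" "q \<le> 1" using assms(1) by (auto simp: q_def field_simps)
  have "(1 + \<epsilon>) * q \<le> (1 + 1 / (2 * real r)) * q"
    using assms(3) q by (intro mult_right_mono) auto
  \<comment> \<open>The gap between \<open>q\<close> and 1 is at least \<open>1 / r\<close>; the
    factor \<open>1 + 1 / (2 * r)\<close> closes at most half of it.\<close>
  also have "\<dots> \<le> 1 - 1 / (2 * r)"
  proof -
    have "1 / (2 * real r) * q \<le> 1 / (2 * real r)" using q assms(1) by (simp add: field_simps)
    moreover have "q \<le> 1 - 1 / r" using assms(1) by (simp add: q_def field_simps)
    ultimately show ?thesis by (simp add: algebra_simps)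
  qed
  finally have eq: "(1 + \<epsilon>) * q \<le> 1 - 1 / (2 * r)" .
  have e1: "\<epsilon> \<le> 1" proof -
    have "1 / (2 * real r) \<le> 1" using assms(1) by simp
    with assms(3) show ?thesis by linarith
  qed
  have fin: "finite F" using assms(5) by (rule finite_subset) (simp add: finite_imp_finite_nsets)
  have "real (n choose 2) - card F \<le> (1 + \<epsilon>) * turan_number r n"
    using turannical_imp_many_hyperedges[OF fin _ _ _ assms(6)] assms(1,5) by (auto simp: nsets_def)
  moreover have "2 * real (n choose 2) = (real n)\<^sup>2 - n"
  proof -
    have "2 * (n choose 2) = n * (n - 1)" by (cases n) (simp_all add: choose_two)
    then have "2 * real (n choose 2) = real n * real (n - 1)" by (metis of_nat_mult of_nat_numeral)
    then show ?thesis by (cases n) (auto simp: power2_eq_square algebra_simps)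
  qed
  moreover have "(1 + \<epsilon>) * (2 * turan_number r n) \<le> (1 + \<epsilon>) * (q * (real n)\<^sup>2 + n)"
    using turan_number_bounds(2)[of r n] assms(1,2) by (intro mult_left_mono) (auto simp: q_def)
  moreover have "(1 + \<epsilon>) * (q * (real n)\<^sup>2 + n) \<le> (1 - 1 / (2 * r)) * (real n)\<^sup>2 + 2 * n"
  proof -
    have "(1 + \<epsilon>) * q * (real n)\<^sup>2 \<le> (1 - 1 / (2 * r)) * (real n)\<^sup>2"
      using eq by (intro mult_right_mono) auto
    moreover have "(1 + \<epsilon>) * n \<le> 2 * real n" using e1 by (intro mult_right_mono) auto
    ultimately show ?thesis by (simp add: algebra_simps)
  qed
  \<comment> \<open>The linear errors, \<open>n\<close> from the binomial and \<open>2 * n\<close>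
    from the Turan bound, use up at most half of the gap \<open>n^2 / (2 * r)\<close>.\<close>
  moreover have "3 * n \<le> (real n)\<^sup>2 / (4 * r)"
  proof -
    have "real n * (12 * r) \<le> real n * n" using assms(4) by (intro mult_left_mono) (auto simp flip: of_nat_mult)
    then show ?thesis using assms(1) by (simp add: field_simps power2_eq_square)
  qed
  ultimately show ?thesis by (simp add: algebra_simps)
qed

section \<open>Tail and avoidance estimates for the random hypergraph\<close>

text \<open>Exponential Markov inequality: independence factorises the moment into
  \<open>n choose r\<close> equal factors, each at most \<open>exp (2 * p)\<close>.\<close>

lemma random_hypergraph_card_tail:
  assumes "0 \<le> p" "p \<le> 1"
  shows "measure_pmf.prob (random_hypergraph r n p) {F. F \<subseteq> [{1..n}]\<^bsup>r\<^esup> \<and> m \<le> real (card F)}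
    \<le> exp (2 * p * real n ^ r - m)"
proof -
  let ?A = "[{1..n}]\<^bsup>r\<^esup>"
  let ?P = "Pi_pmf ?A False (\<lambda>_. bernoulli_pmf p)"
  let ?w = "\<lambda>b::bool. if b then exp 1 else 1 :: real"
  have finA: "finite ?A" by (simp add: finite_imp_finite_nsets)
  have "finite (set_pmf ?P)"
    by (rule finite_subset[OF set_Pi_pmf_subset'[OF finA]]) (intro finite_PiE_dflt finA, simp)
  then have int: "integrable ?P (g :: _ \<Rightarrow> real)" for g by (rule integrable_measure_pmf_finite)
  \<comment> \<open>Writing the exponential of the count as a product over potential hyperedges
    prepares the factorisation of its expectation.\<close>
  have w: "(\<Prod>x\<in>?A. ?w (f x)) = exp (card {x \<in> ?A. f x})" for f
  proof -
    have "(\<Prod>x\<in>?A. ?w (f x)) = (\<Prod>x\<in>{x \<in> ?A. f x}. exp 1)"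
      by (rule prod.inter_filter[OF finA, symmetric])
    then show ?thesis by (simp add: exp_of_nat_mult[of _ "1::real", simplified])
  qed
  have "measure_pmf.prob (random_hypergraph r n p) {F. F \<subseteq> ?A \<and> m \<le> real (card F)}
     = measure_pmf.prob ?P {f. exp m \<le> exp (card {x \<in> ?A. f x})}"
    by (auto simp: random_hypergraph_def vimage_def intro!: arg_cong2[where f = measure])
  also have "\<dots> \<le> measure_pmf.expectation ?P (\<lambda>f. exp (card {x \<in> ?A. f x})) / exp m"
    using integral_Markov_inequality_measure[OF int, of "{}" "\<lambda>f. exp (card {x \<in> ?A. f x})" "exp m"] by simp
  also have "measure_pmf.expectation ?P (\<lambda>f. exp (card {x \<in> ?A. f x}))
     = measure_pmf.expectation ?P (\<lambda>f. \<Prod>x\<in>?A. ?w (f x))"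
    by (simp only: w)
  also have "\<dots> = (\<Prod>x\<in>?A. measure_pmf.expectation (bernoulli_pmf p) ?w)"
    using finA by (intro expectation_prod_Pi_pmf) (auto intro: integrable_measure_pmf_finite)
  also have "measure_pmf.expectation (bernoulli_pmf p) ?w = 1 + p * (exp 1 - 1)"
    using assms by (simp add: algebra_simps)
  also have "(\<Prod>x\<in>?A. 1 + p * (exp 1 - 1)) = (1 + p * (exp 1 - 1)) ^ (n choose r)"
    by simp
  also have "\<dots> \<le> exp (2 * p) ^ (n choose r)"
  proof (rule power_mono)
    \<comment> \<open>The constant 2 comes from \<open>exp 1 \<le> 3\<close>.\<close>
    have "p * (exp 1 - 1) \<le> p * 2" using assms exp_le by (intro mult_left_mono) auto
    then show "1 + p * (exp 1 - 1) \<le> exp (2 * p)" using exp_ge_add_one_self[of "2 * p"] by linarith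
  qed (use assms in auto)
  also have "\<dots> = exp (2 * p * (n choose r))"
    by (simp add: exp_of_nat_mult[symmetric] algebra_simps)
  also have "\<dots> \<le> exp (2 * p * real n ^ r)"
  proof -
    have "n choose r \<le> n ^ r" by (cases "r \<le> n") (auto simp: binomial_le_pow binomial_eq_0)
    then have "real (n choose r) \<le> n ^ r" by (metis of_nat_le_iff of_nat_power)
    then show ?thesis using assms by (auto intro!: mult_left_mono)
  qed
  finally show ?thesis by (simp add: exp_diff divide_right_mono)
qed

lemma random_hypergraph_avoids:
  assumes "0 \<le> p" "p \<le> 1" "K \<subseteq> [{1..n}]\<^bsup>r\<^esup>"
  shows "measure_pmf.prob (random_hypergraph r n p) {F. F \<inter> K = {}} \<le> exp (- p * card K)"
proof -
  let ?A = "[{1..n}]\<^bsup>r\<^esup>"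
  let ?P = "Pi_pmf ?A False (\<lambda>_. bernoulli_pmf p)"
  have finA: "finite ?A" by (simp add: finite_imp_finite_nsets)
  \<comment> \<open>Avoiding \<open>K\<close> is a product event: indicators on \<open>K\<close> are
    forced to be \<open>False\<close>, all others are free.\<close>
  let ?B = "\<lambda>x. if x \<in> K then {False} else UNIV"
  have "measure_pmf.prob (random_hypergraph r n p) {F. F \<inter> K = {}} = measure_pmf.prob ?P (Pi ?A ?B)"
    using assms(3) by (auto simp: random_hypergraph_def vimage_def Pi_def intro!: arg_cong2[where f = measure])
  also have "\<dots> = (\<Prod>x\<in>?A. measure_pmf.prob (bernoulli_pmf p) (?B x))"
    by (rule measure_Pi_pmf_Pi[OF finA])
  also have "\<dots> = (\<Prod>x\<in>?A. if x \<in> K then 1 - p else 1)"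
    using assms by (intro prod.cong) (auto simp: measure_pmf_single)
  also have "\<dots> = (\<Prod>x\<in>{x \<in> ?A. x \<in> K}. 1 - p)"
    by (rule prod.inter_filter[OF finA, symmetric])
  also have "{x \<in> ?A. x \<in> K} = K" using assms(3) by auto
  also have "(\<Prod>x\<in>K. 1 - p) \<le> exp (- p) ^ card K"
    using assms exp_ge_add_one_self[of "- p"] by (auto intro!: power_mono)
  also have "\<dots> = exp (- p * card K)"
    by (simp add: exp_of_nat_mult[symmetric] algebra_simps)
  finally show ?thesis .
qed

section \<open>Upper threshold: many cliques in dense graphs and a union bound\<close>

lemma dense_graph_many_cliques:
  fixes r :: nat and \<epsilon> :: real
  assumes "r \<ge> 3" "0 < \<epsilon>" "\<epsilon> \<le> 1"
  obtains \<delta> :: real and n0 where "\<delta> > 0"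
    "\<And>(n::nat) E. n \<ge> n0 \<Longrightarrow> E \<subseteq> [{1..n}]\<^bsup>2\<^esup> \<Longrightarrow> real (card E) > (1 + \<epsilon>) * turan_number r n
       \<Longrightarrow> \<delta> * real n ^ r \<le> card (cliques E {1..n} r)"
proof -
  \<comment> \<open>\<open>q\<close> is the Turan density and \<open>q + \<eta>\<close> the relative
    minimum degree aimed for: strictly above \<open>q\<close>, yet at most 1.\<close>
  define k q \<eta> \<gamma> where "k = real r - 1" and "q = 1 - 1 / k" and "\<eta> = \<epsilon> / (4 * k)" and "\<gamma> = \<epsilon> / 16"
  have k: "k \<ge> 2" using assms(1) by (auto simp: k_def)
  have q: "1 / 2 \<le> q" "q \<le> 1" using k by (auto simp: q_def field_simps)
  have \<eta>: "0 < \<eta>" "\<eta> \<le> 1 / (4 * k)" "\<eta> \<le> \<epsilon> / 8"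
    using assms k by (auto simp: \<eta>_def field_simps)
  have "1 / (4 * k) \<le> 1 / k" using k by (simp add: field_simps)
  with \<eta> have a: "0 \<le> q + \<eta>" "q + \<eta> \<le> 1" using q by (auto simp: q_def)
  \<comment> \<open>At density exactly \<open>q\<close> the coefficient of clique growth vanishes,
    so only the contribution of \<open>\<eta>\<close> remains.\<close>
  have b: "1 - k * (1 - (q + \<eta>)) = k * \<eta>" using k by (simp add: q_def field_simps)
  have "0 \<le> k * \<eta>" using k \<eta> by simp
  with b have b1: "k * (1 - (q + \<eta>)) \<le> 1" by linarith
  define \<delta> where "\<delta> = (k * \<eta> * sqrt \<gamma>) ^ r / fact r"
  have \<gamma>: "0 < \<gamma>" using assms by (simp add: \<gamma>_def)
  have \<delta>: "\<delta> > 0" using k \<eta> \<gamma> by (simp add: \<delta>_def)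
  have "\<delta> * real n ^ r \<le> card (cliques E {1..n} r)"
    if n: "n \<ge> nat \<lceil>16 / \<epsilon>\<rceil>" and E: "E \<subseteq> [{1..n}]\<^bsup>2\<^esup>"
      and big: "real (card E) > (1 + \<epsilon>) * turan_number r n" for n E
  proof -
    have "(1 + \<epsilon>) * (q * (real n)\<^sup>2 - n) \<le> 2 * ((1 + \<epsilon>) * turan_number r n)"
    proof -
      have "(1 + \<epsilon>) * (q * (real n)\<^sup>2 - n) \<le> (1 + \<epsilon>) * (2 * turan_number r n)"
        using turan_number_bounds(1)[of r n] assms by (intro mult_left_mono) (auto simp: q_def k_def)
      then show ?thesis by simp
    qed
    \<comment> \<open>The surplus \<open>\<epsilon> * q * n^2\<close> is at least
      \<open>\<epsilon> / 2 * n^2\<close>. The terms with \<open>\<eta>\<close> and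
      \<open>2 * \<gamma>\<close> take at most \<open>\<epsilon> / 8\<close> each; the remaining
      \<open>\<epsilon> / 4\<close> covers the linear terms, at most \<open>3 * n\<close>, once
      \<open>n \<ge> 16 / \<epsilon>\<close>.\<close>
    moreover have "(q + \<eta>) * n * (n + 1) + 2 * \<gamma> * (real n)\<^sup>2 \<le> (1 + \<epsilon>) * (q * (real n)\<^sup>2 - n)"
    proof -
      have "16 / \<epsilon> \<le> n" using n by linarith
      then have "16 \<le> \<epsilon> * n" using assms by (simp add: field_simps)
      then have "16 * real n \<le> \<epsilon> * n * n" by (intro mult_right_mono) auto
      then have *: "4 * n \<le> \<epsilon> / 4 * (real n)\<^sup>2" by (simp add: power2_eq_square)
      have "(q + \<eta>) * n \<le> 1 * real n" "\<epsilon> * n \<le> 1 * real n" using a assms by (intro mult_right_mono; simp)+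
      moreover have "\<epsilon> * (1 / 2) * (real n)\<^sup>2 \<le> \<epsilon> * q * (real n)\<^sup>2"
        using q assms by (intro mult_right_mono mult_left_mono) auto
      moreover have "\<eta> * (real n)\<^sup>2 \<le> \<epsilon> / 8 * (real n)\<^sup>2" using \<eta> by (intro mult_right_mono) auto
      ultimately show ?thesis using * by (simp add: \<gamma>_def algebra_simps power2_eq_square)
    qed
    ultimately have "(q + \<eta>) * card {1..n} * (card {1..n} + 1) / 2 + \<gamma> * (card {1..n})\<^sup>2 \<le> card E"
      using big by (simp add: add.commute)
    from clique_supersaturation[OF _ E a _ _ this, of r]
    have "(k * \<eta> * sqrt \<gamma> * n) ^ r \<le> fact r * card (cliques E {1..n} r)"
      using \<gamma> b b1 by (simp add: k_def)
    then show ?thesis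
      by (simp add: \<delta>_def field_simps power_mult_distrib)
  qed
  with \<delta> show thesis by (rule that)
qed

text \<open>If \<open>F\<close> fails, it avoids all \<open>r\<close>-cliques of some dense graph.
  Each such event has probability at most \<open>exp (- p * m)\<close>, and there are at most
  \<open>exp (n^2)\<close> graphs.\<close>

lemma prob_not_turannical_le:
  fixes \<epsilon> m :: real
  assumes "0 \<le> p" "p \<le> 1"
    and cl: "\<And>E. E \<subseteq> [{1..n}]\<^bsup>2\<^esup> \<Longrightarrow> real (card E) > (1 + \<epsilon>) * turan_number r n
       \<Longrightarrow> m \<le> card (cliques E {1..n} r)"
  shows "1 - measure_pmf.prob (random_hypergraph r n p) {F. turannical r \<epsilon> {1..n} F}
    \<le> exp ((real n)\<^sup>2 - p * m)"
proof -
  let ?H = "random_hypergraph r n p"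
  define \<E> where "\<E> = {E. E \<subseteq> [{1..n}]\<^bsup>2\<^esup> \<and> real (card E) > (1 + \<epsilon>) * turan_number r n}"
  have sub: "\<E> \<subseteq> Pow ([{1..n}]\<^bsup>2\<^esup>)" by (auto simp: \<E>_def)
  have finP: "finite (Pow ([{1..n}]\<^bsup>2\<^esup>))" by (simp add: finite_imp_finite_nsets)
  have fin: "finite \<E>" using sub finP by (rule finite_subset)
  have "1 - measure_pmf.prob ?H {F. turannical r \<epsilon> {1..n} F}
      = measure_pmf.prob ?H (UNIV - {F. turannical r \<epsilon> {1..n} F})"
    using measure_pmf.prob_compl[of "{F. turannical r \<epsilon> {1..n} F}" ?H] by simp
  also have "\<dots> \<le> measure_pmf.prob ?H (\<Union>E\<in>\<E>. {F. F \<inter> cliques E {1..n} r = {}})"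
  proof (rule measure_pmf.finite_measure_mono)
    show "UNIV - {F. turannical r \<epsilon> {1..n} F} \<subseteq> (\<Union>E\<in>\<E>. {F. F \<inter> cliques E {1..n} r = {}})"
    proof
      fix F assume "F \<in> UNIV - {F. turannical r \<epsilon> {1..n} F}"
      then obtain E where E: "E \<in> \<E>" "\<not> detects r F E" by (auto simp: turannical_def \<E>_def)
      then have "F \<inter> cliques E {1..n} r = {}"
        using clique_iff_induced_edges[of E "{1..n}"]
        by (auto simp: \<E>_def detects_def cliques_def nsets_def[of _ r])
      with E(1) show "F \<in> (\<Union>E\<in>\<E>. {F. F \<inter> cliques E {1..n} r = {}})" by auto
    qed
  qed simp
  also have "\<dots> \<le> (\<Sum>E\<in>\<E>. measure_pmf.prob ?H {F. F \<inter> cliques E {1..n} r = {}})"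
    using fin by (intro measure_pmf.finite_measure_subadditive_finite) auto
  also have "\<dots> \<le> (\<Sum>E\<in>\<E>. exp (- p * m))"
  proof (rule sum_mono)
    fix E assume "E \<in> \<E>"
    then have "m \<le> card (cliques E {1..n} r)" using cl by (auto simp: \<E>_def)
    then have "exp (- p * card (cliques E {1..n} r)) \<le> exp (- p * m)"
      using assms(1) by (simp add: mult_left_mono)
    moreover have "measure_pmf.prob ?H {F. F \<inter> cliques E {1..n} r = {}}
        \<le> exp (- p * card (cliques E {1..n} r))"
      by (rule random_hypergraph_avoids[OF assms(1,2)]) (auto simp: cliques_def)
    ultimately show "measure_pmf.prob ?H {F. F \<inter> cliques E {1..n} r = {}} \<le> exp (- p * m)" by linarith
  qed
  also have "\<dots> = card \<E> * exp (- p * m)" by simp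
  also have "\<dots> \<le> exp ((real n)\<^sup>2) * exp (- p * m)"
  proof (rule mult_right_mono)
    have "card \<E> \<le> card (Pow ([{1..n}]\<^bsup>2\<^esup>))" by (rule card_mono[OF finP sub])
    also have "\<dots> = 2 ^ (n choose 2)" by (simp add: card_Pow finite_imp_finite_nsets)
    also have "\<dots> \<le> 2 ^ (n\<^sup>2)"
      by (intro power_increasing) (cases "2 \<le> n", auto simp: binomial_le_pow binomial_eq_0)
    finally have "real (card \<E>) \<le> 2 ^ (n\<^sup>2)" by (metis of_nat_le_iff of_nat_numeral of_nat_power)
    also have "\<dots> \<le> exp 1 ^ (n\<^sup>2)"
      using exp_ge_add_one_self[of 1] by (intro power_mono) auto
    also have "\<dots> = exp ((real n)\<^sup>2)" using exp_of_nat_mult[of "n\<^sup>2" "1::real"] by simp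
    finally show "real (card \<E>) \<le> exp ((real n)\<^sup>2)" .
  qed simp
  finally show ?thesis by (simp add: exp_diff exp_minus field_simps)
qed

section \<open>The threshold at order \<open>n^(2 - r)\<close>\<close>

text \<open>At this order of \<open>p\<close> the product \<open>p * n^r\<close> has order
  \<open>n^2\<close>, the scale of both exponential bounds.\<close>

lemma powi_two_minus_mult_power:
  "n > 0 \<Longrightarrow> real n powi (2 - int r) * n ^ r = (real n)\<^sup>2"
  by (simp add: power_int_diff)

text \<open>The bounds on \<open>p\<close> are assumed only eventually: at \<open>n = 1\<close> the
  lower bound reads \<open>p 1 \<ge> C\<close>, which is impossible for \<open>C > 1\<close>, so
  demanding it for all \<open>n\<close> could make the second claim vacuous.\<close>

theorem theorem2p3:
  fixes r :: nat and \<epsilon> :: real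
  assumes "r \<ge> 3" and "0 < \<epsilon>" and "\<epsilon> \<le> 1 / (2 * real r)"
  shows "\<exists>c C :: real. c > 0 \<and> C > 0 \<and>
    (\<forall>p :: nat \<Rightarrow> real. (\<forall>n. 0 \<le> p n \<and> p n \<le> 1) \<longrightarrow>
      ((\<forall>\<^sub>F n in sequentially. p n \<le> c * real n powi (2 - int r)) \<longrightarrow>
        (\<lambda>n. measure_pmf.prob (random_hypergraph r n (p n)) {F. turannical r \<epsilon> {1..n} F})
          \<longlonglongrightarrow> 0) \<and>
      ((\<forall>\<^sub>F n in sequentially. p n \<ge> C * real n powi (2 - int r)) \<longrightarrow>
        (\<lambda>n. measure_pmf.prob (random_hypergraph r n (p n)) {F. turannical r \<epsilon> {1..n} F})
          \<longlonglongrightarrow> 1))"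
proof -
  have "1 / (2 * real r) \<le> 1" using assms(1) by simp
  with assms have "\<epsilon> \<le> 1" by linarith
  from dense_graph_many_cliques[OF assms(1,2) this]
  obtain \<delta> :: real and n0 where \<delta>: "\<delta> > 0" and cl:
    "\<And>(n::nat) E. n \<ge> n0 \<Longrightarrow> E \<subseteq> [{1..n}]\<^bsup>2\<^esup> \<Longrightarrow> real (card E) > (1 + \<epsilon>) * turan_number r n
       \<Longrightarrow> \<delta> * real n ^ r \<le> card (cliques E {1..n} r)"
    by metis
  let ?pr = "\<lambda>p n. measure_pmf.prob (random_hypergraph r n (p n)) {F. turannical r \<epsilon> {1..n} F}"
  \<comment> \<open>As \<open>1 / (8 * r) = 4 * c\<close>, the tail exponent is at most
    \<open>(2 * c - 4 * c) * n^2\<close>. The choice of \<open>C\<close> makes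
    \<open>p * \<delta> * n^r\<close> at least \<open>2 * n^2\<close>, twice the entropy term
    \<open>n^2\<close> of the union bound.\<close>
  define c C where "c = 1 / (32 * real r)" and "C = 2 / \<delta>"
  have pos: "c > 0" "C > 0" using assms(1) \<delta> by (auto simp: c_def C_def)
  have lim: "(\<lambda>n. exp (- (x * (real n)\<^sup>2))) \<longlonglongrightarrow> 0" if "x > 0" for x
    using that by real_asymp
  have "?pr p \<longlonglongrightarrow> 0" if p: "\<And>n. 0 \<le> p n \<and> p n \<le> 1"
    and small: "\<forall>\<^sub>F n in sequentially. p n \<le> c * real n powi (2 - int r)" for p
  proof (rule tendsto_sandwich[OF _ _ tendsto_const lim[of "2 * c"]])
    show "\<forall>\<^sub>F n in sequentially. ?pr p n \<le> exp (- (2 * c * (real n)\<^sup>2))"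
      using small eventually_ge_at_top[of "16 * r"] eventually_gt_at_top[of 0]
    proof eventually_elim
      case (elim n)
      let ?H = "random_hypergraph r n (p n)"
      \<comment> \<open>Restricting to the support supplies \<open>r\<close>-uniformity, which the
        bound on the number of hyperedges requires.\<close>
      have "?pr p n = measure_pmf.prob ?H ({F. turannical r \<epsilon> {1..n} F} \<inter> set_pmf ?H)"
        by (rule measure_Int_set_pmf[symmetric])
      also have "\<dots> \<le> measure_pmf.prob ?H {F. F \<subseteq> [{1..n}]\<^bsup>r\<^esup> \<and> (real n)\<^sup>2 / (8 * r) \<le> card F}"
      proof (rule measure_pmf.finite_measure_mono)
        have "set_pmf ?H \<subseteq> Pow ([{1..n}]\<^bsup>r\<^esup>)" by (auto simp: random_hypergraph_def)
        then show "{F. turannical r \<epsilon> {1..n} F} \<inter> set_pmf ?H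
            \<subseteq> {F. F \<subseteq> [{1..n}]\<^bsup>r\<^esup> \<and> (real n)\<^sup>2 / (8 * r) \<le> card F}"
          using turannical_card_hyperedges_ge[OF assms elim(2)] by blast
      qed simp
      also have "\<dots> \<le> exp (2 * p n * real n ^ r - (real n)\<^sup>2 / (8 * r))"
        using p[of n] by (intro random_hypergraph_card_tail) auto
      also have "\<dots> \<le> exp (- (2 * c * (real n)\<^sup>2))"
      proof -
        have "p n * n ^ r \<le> c * real n powi (2 - int r) * n ^ r"
          using elim(1) by (intro mult_right_mono) auto
        also have "\<dots> = c * (real n)\<^sup>2"
          using powi_two_minus_mult_power[OF elim(3), of r] by simp
        finally show ?thesis by (simp add: c_def)
      qed
      finally show ?case .
    qed
  qed (use pos in auto)
  moreover have "?pr p \<longlonglongrightarrow> 1" if p: "\<And>n. 0 \<le> p n \<and> p n \<le> 1"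
    and large: "\<forall>\<^sub>F n in sequentially. p n \<ge> C * real n powi (2 - int r)" for p
  proof -
    have "(\<lambda>n. 1 - ?pr p n) \<longlonglongrightarrow> 0"
    proof (rule tendsto_sandwich[OF _ _ tendsto_const lim[of 1]])
      show "\<forall>\<^sub>F n in sequentially. 1 - ?pr p n \<le> exp (- (1 * (real n)\<^sup>2))"
        using large eventually_ge_at_top[of n0] eventually_gt_at_top[of 0]
      proof eventually_elim
        case (elim n)
        have "1 - ?pr p n \<le> exp ((real n)\<^sup>2 - p n * (\<delta> * real n ^ r))"
          by (rule prob_not_turannical_le) (use p[of n] in \<open>auto intro: cl[OF elim(2)] simp del: One_nat_def\<close>)
        also have "\<dots> \<le> exp (- (1 * (real n)\<^sup>2))"
        proof -
          have "2 * (real n)\<^sup>2 = \<delta> * C * (real n powi (2 - int r) * n ^ r)"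
            using powi_two_minus_mult_power[OF elim(3), of r] \<delta> by (simp add: C_def)
          also have "\<dots> = (C * real n powi (2 - int r)) * (\<delta> * real n ^ r)" by simp
          also have "\<dots> \<le> p n * (\<delta> * real n ^ r)"
            using elim(1) \<delta> by (intro mult_right_mono) auto
          finally show ?thesis by simp
        qed
        finally show ?case .
      qed
    qed (auto simp: measure_pmf.prob_le_1)
    from tendsto_diff[OF tendsto_const[of 1] this] show ?thesis by simp
  qed
  ultimately show ?thesis using pos by blast
qed

end
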